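(* Let $\alpha>0$ and $c_\alpha>0$ be real numbers, and consider the purely nonlinear generalized isotonic oscillator governed by the potential $$U(q)=\frac{c_\alpha}{8}\left(|q|^{\frac{\alpha+1}{2}}-\frac{1}{|q|^{\frac{\alpha+1}{2}}}\right)^2,$$ with equation of motion $$\ddot q+\frac{c_\alpha(\alpha+1)}{8}\,q^\alpha=\frac{c_\alpha(\alpha+1)}{8\,q^{\alpha+2}},\qquad 0<q<\infty,$$ subject to the initial conditions $q(0)=q_0$ and $\dot q(0)=0$, where $q_0\in(0,\infty)$. Put $$k_\alpha=\sqrt{\frac{2U(q_0)}{c_\alpha}}.$$ Then the time period $T$ of the oscillation is given by $$T=\frac{4}{\sqrt{c_\alpha}\,(\alpha+1)}\sum_{m=0}^\infty\sum_{n=0}^\infty\binom{\frac{2}{\alpha+1}}{2m}\binom{\frac{1}{\alpha+1}-\frac12-m}{n}\,k_\alpha^{2(m+n)}\,B\!\left(m+n+\tfrac12,\tfrac12\right).$$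
   Context: Dots denote derivatives with respect to time $t$. The time period $T$ is the period of the solution $q(t)$ with the given initial data, i.e. the time taken to traverse once the closed orbit in the $(q,\dot q)$ phase plane through $(q_0,0)$. For real $r$ and integer $j\ge 0$, $\binom{r}{j}=\frac{r(r-1)\cdots(r-j+1)}{j!}$ is the generalized binomial coefficient (equal to $1$ when $j=0$). $B(a,b)=\int_0^1 z^{a-1}(1-z)^{b-1}\,dz=\frac{\Gamma(a)\Gamma(b)}{\Gamma(a+b)}$ is the Euler Beta function.
   Formalization: The formula is proved for k_α < 1 or α = 1; otherwise the printed series diverges (for k_α > 1 already its m = 0 inner sum). For q_0 = 1, the equilibrium, there is no least period, and T is only shown to be a period. *)

theory Defs
  imports "HOL-Analysis.Analysis"
begin

definition potential :: "real \<Rightarrow> real \<Rightarrow> real \<Rightarrow> real" where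
  "potential \<alpha> c x =
     c / 8 * (\<bar>x\<bar> powr ((\<alpha> + 1) / 2) - 1 / \<bar>x\<bar> powr ((\<alpha> + 1) / 2))\<^sup>2"

definition modulus :: "real \<Rightarrow> real \<Rightarrow> real \<Rightarrow> real" where
  "modulus \<alpha> c q0 = sqrt (2 * potential \<alpha> c q0 / c)"

text \<open>The system is autonomous and all its orbits are closed, so solutions are taken on the
  whole time axis.\<close>

definition solves_oscillator :: "real \<Rightarrow> real \<Rightarrow> real \<Rightarrow> (real \<Rightarrow> real) \<Rightarrow> bool" where
  "solves_oscillator \<alpha> c q0 q \<longleftrightarrow>
     (\<forall>t. 0 < q t \<and> q differentiable (at t) \<and> deriv q differentiable (at t) \<and>
        deriv (deriv q) t + c * (\<alpha> + 1) / 8 * q t powr \<alpha>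
          = c * (\<alpha> + 1) / (8 * q t powr (\<alpha> + 2))) \<and>
     q 0 = q0 \<and> deriv q 0 = 0"

definition phase_curve :: "(real \<Rightarrow> real) \<Rightarrow> real \<Rightarrow> real \<times> real" where
  "phase_curve q t = (q t, deriv q t)"

definition is_period :: "(real \<Rightarrow> 'a) \<Rightarrow> real \<Rightarrow> bool" where
  "is_period \<gamma> T \<longleftrightarrow> 0 < T \<and> (\<forall>t. \<gamma> (t + T) = \<gamma> t)"

definition is_least_period :: "(real \<Rightarrow> 'a) \<Rightarrow> real \<Rightarrow> bool" where
  "is_least_period \<gamma> T \<longleftrightarrow> is_period \<gamma> T \<and> (\<forall>S. is_period \<gamma> S \<longrightarrow> T \<le> S)"

definition series_term :: "real \<Rightarrow> real \<Rightarrow> nat \<Rightarrow> nat \<Rightarrow> real" where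
  "series_term \<alpha> k m n =
     ((2 / (\<alpha> + 1)) gchoose (2 * m)) * ((1 / (\<alpha> + 1) - 1 / 2 - real m) gchoose n)
       * k ^ (2 * (m + n)) * Beta (real m + real n + 1 / 2) (1 / 2)"

end

theory Submission imports Defs begin

text \<open>Set \<open>p = 2 / (\<alpha> + 1)\<close>. In the coordinates \<open>X = (q powr (1/p) - q powr (-1/p)) / 2\<close> and
  \<open>Y = q' / sqrt c\<close> the equation of motion is the rotation \<open>X' = \<omega> X * Y\<close>, \<open>Y' = - \<omega> X * X\<close> with the
  position-dependent speed \<open>\<omega> x = sqrt c / p * sqrt (1 + x\<^sup>2) / (sqrt (1 + x\<^sup>2) + x) powr p\<close>.
  Integrating \<open>\<omega> (X t)\<close> gives an angle \<open>\<theta>\<close> with \<open>X = A * sin \<theta>\<close>, \<open>Y = A * cos \<theta>\<close>, and the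
  period is the integral of \<open>1 / \<omega> (A * sin \<theta>)\<close> over one turn. Only the even part of \<open>1 / \<omega>\<close>
  contributes. Its binomial expansion in \<open>x / sqrt (1 + x\<^sup>2)\<close> yields the sum over \<open>m\<close>, the binomial
  expansion of the remaining powers of \<open>1 + x\<^sup>2\<close> the sum over \<open>n\<close>, and the even moments of the
  sine are Beta values.\<close>

section \<open>Termwise integration, sine moments and binomial series\<close>

text \<open>The Weierstrass M-test makes the convergence uniform, so limit and integral may be
  exchanged. It is applied once to the sum over \<open>n\<close> and once to the sum over
  \<open>m\<close>.\<close>

lemma sums_integral_of_normal_series:
  fixes f :: "nat \<Rightarrow> real \<Rightarrow> real"
  assumes cont: "\<And>n. continuous_on {a..b} (f n)"
    and bound: "\<And>n x. x \<in> {a..b} \<Longrightarrow> \<bar>f n x\<bar> \<le> M n"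
    and "summable M"
    and sums: "\<And>x. x \<in> {a..b} \<Longrightarrow> (\<lambda>n. f n x) sums g x"
  shows "(\<lambda>n. integral {a..b} (f n)) sums integral {a..b} g"
proof -
  have "uniform_limit {a..b} (\<lambda>n x. \<Sum>i<n. f i x) (\<lambda>x. \<Sum>i. f i x) sequentially"
    using bound \<open>summable M\<close> by (intro Weierstrass_m_test) auto
  then have lim: "uniform_limit {a..b} (\<lambda>n x. \<Sum>i<n. f i x) g sequentially"
    using sums by (elim uniform_limit_cong'[THEN iffD1, rotated 2]) (auto simp: sums_iff)
  have "continuous_on {a..b} (\<lambda>x. \<Sum>i<n. f i x)" for n
    by (intro continuous_on_sum cont)
  with lim obtain I J where IJ: "\<And>n. ((\<lambda>x. \<Sum>i<n. f i x) has_integral I n) {a..b}"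
      "(g has_integral J) {a..b}" "I \<longlonglongrightarrow> J"
    using uniform_limit_integral[OF lim] by (metis sequentially_bot)
  have "f i integrable_on {a..b}" for i
    using cont by (rule integrable_continuous_real)
  then have "((\<lambda>x. \<Sum>i<n. f i x) has_integral (\<Sum>i<n. integral {a..b} (f i))) {a..b}" for n
    by (intro has_integral_sum) auto
  with IJ(1) have "I = (\<lambda>n. \<Sum>i<n. integral {a..b} (f i))"
    using has_integral_unique by blast
  with IJ(2,3) show ?thesis
    by (simp add: sums_def integral_unique)
qed

text \<open>Wallis recursion: \<open>- cos x * sin x ^ (2*n+1)\<close> vanishes at both ends, so
  integrating its derivative links consecutive even moments, with the same ratio as in
  \<open>Beta (a + 1) b = a / (a + b) * Beta a b\<close>.\<close>

lemma has_integral_sin_power_even: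
  "((\<lambda>x. sin x ^ (2 * n)) has_integral 2 * Beta (real n + 1/2) (1/2)) {-pi..pi}"
proof (induction n)
  case 0
  have "Beta (1/2) (1/2 :: real) = pi"
    by (simp add: Beta_def Gamma_one_half_real)
  then show ?case
    using has_integral_const_real[of "1::real" "-pi" pi] by simp
next
  case (Suc n)
  define B where "B = Beta (real n + 1/2) (1/2)"
  have "real n + 1/2 \<notin> \<int>\<^sub>\<le>\<^sub>0"
    by (auto elim!: nonpos_Ints_cases')
  then have rec: "Beta (real (Suc n) + 1/2) (1/2) = (real n + 1/2) / (real n + 1) * B"
    using Beta_plus1_left[of "real n + 1/2" "1/2"] by (simp add: B_def field_simps add_ac)
  have "((\<lambda>x. (2 * real n + 2) * sin x ^ (2 * Suc n) - (2 * real n + 1) * sin x ^ (2 * n))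
      has_integral (- cos pi * sin pi ^ (2*n+1)) - (- cos (-pi) * sin (-pi) ^ (2*n+1))) {-pi..pi}"
  proof (rule fundamental_theorem_of_calculus)
    fix x :: real
    \<comment> \<open>The factor \<open>s\<^sup>2 + c\<^sup>2\<close> is kept so that it collapses
      to 1 for sine and cosine, leaving only even powers of the sine.\<close>
    have "s * s ^ (2*n+1) - c * ((2 * real n + 1) * s ^ (2*n) * c)
        = (2 * real n + 2) * s ^ (2 * Suc n) - (2 * real n + 1) * s ^ (2*n) * (s\<^sup>2 + c\<^sup>2)"
      for s c :: real
      by (simp add: algebra_simps power2_eq_square)
    from this[of "sin x" "cos x"]
    have "sin x * sin x ^ (2*n+1) - cos x * ((2 * real n + 1) * sin x ^ (2*n) * cos x)
        = (2 * real n + 2) * sin x ^ (2 * Suc n) - (2 * real n + 1) * sin x ^ (2*n)"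
      by (simp only: sin_cos_squared_add mult_1_right)
    moreover have "((\<lambda>x. - cos x * sin x ^ (2*n+1)) has_real_derivative
        sin x * sin x ^ (2*n+1) - cos x * ((2 * real n + 1) * sin x ^ (2*n) * cos x)) (at x)"
    proof -
      have cos: "((\<lambda>x. - cos x) has_real_derivative sin x) (at x)"
        by (auto intro!: derivative_eq_intros)
      have sin: "((\<lambda>x. sin x ^ Suc (2*n)) has_real_derivative
          (1 + real (2*n)) * (cos x * sin x ^ (2*n))) (at x)"
        by (intro DERIV_power_Suc DERIV_sin)
      show ?thesis
        using DERIV_mult[OF cos sin] by (simp add: algebra_simps)
    qed
    ultimately have "((\<lambda>x. - cos x * sin x ^ (2*n+1)) has_real_derivative
        (2 * real n + 2) * sin x ^ (2 * Suc n) - (2 * real n + 1) * sin x ^ (2*n)) (at x)"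
      by (simp only:)
    then show "((\<lambda>x. - cos x * sin x ^ (2*n+1)) has_vector_derivative
        (2 * real n + 2) * sin x ^ (2 * Suc n) - (2 * real n + 1) * sin x ^ (2*n))
        (at x within {-pi..pi})"
      unfolding has_real_derivative_iff_has_vector_derivative
      by (rule has_vector_derivative_at_within)
  qed simp
  then have "((\<lambda>x. (2 * real n + 2) * sin x ^ (2 * Suc n) - (2 * real n + 1) * sin x ^ (2 * n))
      has_integral 0) {-pi..pi}"
    by simp
  from has_integral_mult_right[OF has_integral_add[OF this
        has_integral_mult_right[OF Suc.IH, of "2 * real n + 1"]], of "1 / (2 * real n + 2)"]
  have "((\<lambda>x. sin x ^ (2 * Suc n)) has_integral
      (2 * real n + 1) * (2 * B) / (2 * real n + 2)) {-pi..pi}"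
    by (simp add: B_def del: power_Suc mult_Suc_right)
  moreover have "(2 * real n + 1) * (2 * B) / (2 * real n + 2)
      = 2 * Beta (real (Suc n) + 1/2) (1/2)"
    unfolding rec by (simp add: field_simps)
  ultimately show ?case by metis
qed

text \<open>Averaging the binomial series of \<open>(w + x) powr p\<close> and
  \<open>(w - x) powr p\<close> cancels the odd powers of \<open>x\<close>.\<close>

lemma even_gen_binomial_sums:
  fixes w x p :: real
  assumes "\<bar>x\<bar> < w"
  shows "(\<lambda>m. (p gchoose (2*m)) * x ^ (2*m) * w powr (p - 2 * real m))
    sums (((w + x) powr p + (w - x) powr p) / 2)"
proof -
  let ?f = "\<lambda>n. ((p gchoose n) * x ^ n * w powr (p - real n)
      + (p gchoose n) * (-x) ^ n * w powr (p - real n)) / 2"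
  have "?f sums (((x + w) powr p + (-x + w) powr p) / 2)"
    using assms by (intro sums_divide sums_add gen_binomial_real') auto
  moreover have "?f n = 0" if "n \<notin> range (\<lambda>m. 2 * m)" for n
  proof -
    have "odd n" using that by (metis evenE rangeI)
    then show ?thesis by simp
  qed
  ultimately have "(\<lambda>m. ?f (2 * m)) sums (((x + w) powr p + (-x + w) powr p) / 2)"
    by (subst sums_mono_reindex) (auto simp: strict_mono_def)
  then show ?thesis by (simp add: add.commute mult.assoc)
qed

text \<open>Since \<open>A\<^sup>2 < 1\<close>, the binomial series in
  \<open>(A * sin x)\<^sup>2\<close> converges uniformly; integrating it term by term leaves even
  moments of the sine. This yields the inner sum over \<open>n\<close>.\<close>

lemma binomial_moment_sums:
  fixes A b :: real
  assumes "\<bar>A\<bar> < 1"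
  shows "(\<lambda>n. (b gchoose n) * A ^ (2*(m+n)) * (2 * Beta (real m + real n + 1/2) (1/2)))
    sums integral {-pi..pi} (\<lambda>x. (A * sin x) ^ (2*m) * (1 + (A * sin x)\<^sup>2) powr b)"
    (is "_ sums integral _ ?g")
proof -
  let ?f = "\<lambda>n x. (b gchoose n) * A ^ (2*(m+n)) * sin x ^ (2*(m+n))"
  have A2: "A\<^sup>2 < 1"
    using assms by (simp add: abs_square_less_1)
  have "summable (\<lambda>n. \<bar>b gchoose n\<bar> * (A\<^sup>2) ^ n)"
  proof -
    have "summable (\<lambda>n. norm ((b gchoose n) * (A\<^sup>2) ^ n))"
      using A2 by (intro abs_summable_in_conv_radius) (auto simp: conv_radius_gchoose)
    then show ?thesis by (simp add: abs_mult)
  qed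
  \<comment> \<open>The remaining powers of \<open>A\<close> and \<open>sin x\<close> are at most 1,
    so the absolutely convergent binomial series at \<open>A\<^sup>2\<close> is a majorant for all
    \<open>x\<close>.\<close>
  moreover have "\<bar>?f n x\<bar> \<le> \<bar>b gchoose n\<bar> * (A\<^sup>2) ^ n" for n x
  proof -
    have "A ^ (2*m) \<le> 1"
      using A2 by (simp add: power_mult power_le_one)
    moreover have "sin x ^ (2*(m+n)) \<le> 1"
    proof -
      have "(sin x)\<^sup>2 \<le> 1" by (simp add: abs_square_le_1)
      from power_le_one[OF zero_le_power2 this, of "m+n"] show ?thesis
        by (simp only: power_mult)
    qed
    ultimately have "A ^ (2*m) * sin x ^ (2*(m+n)) \<le> 1" (is "?P \<le> 1")
      using zero_le_even_power'[of "sin x" "m+n"] by (intro mult_le_one)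
    then have "(\<bar>b gchoose n\<bar> * (A\<^sup>2) ^ n) * ?P \<le> \<bar>b gchoose n\<bar> * (A\<^sup>2) ^ n"
      by (intro mult_left_le) auto
    moreover have "?f n x = (b gchoose n) * ((A\<^sup>2) ^ n * ?P)"
      by (simp add: distrib_left power_add flip: power_mult)
    moreover have "0 \<le> (A\<^sup>2) ^ n * ?P"
      using zero_le_even_power'[of "sin x" "m+n"] zero_le_even_power'[of A m]
      by (intro mult_nonneg_nonneg) auto
    ultimately show ?thesis
      by (simp only: abs_mult[of "b gchoose n"] abs_of_nonneg mult.assoc)
  qed
  moreover have "(\<lambda>n. ?f n x) sums ?g x" for x
  proof -
    have "\<bar>(A * sin x)\<^sup>2\<bar> < 1"
    proof -
      have "\<bar>A * sin x\<bar> \<le> \<bar>A\<bar> * 1"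
        unfolding abs_mult by (intro mult_left_mono) auto
      then show ?thesis using assms by (simp add: abs_square_less_1)
    qed
    moreover have "(A * sin x) ^ (2*m) * ((b gchoose n) * ((A * sin x)\<^sup>2) ^ n) = ?f n x" for n
      by (simp add: power_mult_distrib distrib_left power_add mult_ac flip: power_mult)
    ultimately show ?thesis
      using sums_mult[OF gen_binomial_real, of "(A * sin x)\<^sup>2" "(A * sin x) ^ (2*m)" b]
      by (simp only:)
  qed
  ultimately have "(\<lambda>n. integral {-pi..pi} (?f n)) sums integral {-pi..pi} ?g"
    by (intro sums_integral_of_normal_series) (auto intro!: continuous_intros)
  moreover have "integral {-pi..pi} (?f n)
      = (b gchoose n) * A ^ (2*(m+n)) * (2 * Beta (real m + real n + 1/2) (1/2))" for n
    using has_integral_mult_right[OF has_integral_sin_power_even[of "m+n"]]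
    by (intro integral_unique) simp
  ultimately show ?thesis by (simp only:)
qed

section \<open>The time density over the angle and its series\<close>

text \<open>For \<open>x = sinh s\<close> this is \<open>exp (p * s) / cosh s\<close>. Up to the
  factor \<open>p / sqrt c\<close> it is the reciprocal of the rotation speed, hence the time spent
  per unit of angle.\<close>

definition period_density :: "real \<Rightarrow> real \<Rightarrow> real" where
  "period_density p x = (sqrt (1 + x\<^sup>2) + x) powr p / sqrt (1 + x\<^sup>2)"

lemma abs_less_sqrt_one_plus_square: "\<bar>x\<bar> < sqrt (1 + x\<^sup>2)" for x :: real
  by (rule real_less_rsqrt) simp

lemma sqrt_one_plus_square_pos: "0 < sqrt (1 + x\<^sup>2)" for x :: real
  using abs_less_sqrt_one_plus_square[of x] by linarith

lemma sqrt_one_plus_square_add_pos: "0 < sqrt (1 + x\<^sup>2) + x" for x :: real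
  using abs_less_sqrt_one_plus_square[of x] by linarith

lemma period_density_pos: "0 < period_density p x"
  using sqrt_one_plus_square_pos[of x] sqrt_one_plus_square_add_pos[of x]
  by (simp add: period_density_def)

lemma continuous_on_period_density [continuous_intros]:
  assumes "continuous_on S f"
  shows "continuous_on S (\<lambda>x. period_density p (f x))"
  unfolding period_density_def using assms
  by (intro continuous_intros)
    (auto simp: less_imp_neq[OF sqrt_one_plus_square_add_pos, symmetric]
       less_imp_neq[OF sqrt_one_plus_square_pos, symmetric] add_nonneg_eq_0_iff)

text \<open>The binomial expansion is taken around \<open>w = sqrt (1 + x\<^sup>2)\<close>, which
  exceeds \<open>\<bar>x\<bar>\<close> for every \<open>x\<close>, so it is valid at every
  amplitude.\<close>

lemma even_part_period_density_sums:
  "(\<lambda>m. (p gchoose (2*m)) * (x ^ (2*m) * (1 + x\<^sup>2) powr (p/2 - 1/2 - real m)))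
    sums ((period_density p x + period_density p (-x)) / 2)"
proof -
  let ?w = "sqrt (1 + x\<^sup>2)"
  have w: "?w > 0" by (rule sqrt_one_plus_square_pos)
  have "(\<lambda>m. (p gchoose (2*m)) * (x ^ (2*m) * (?w powr (p - 2 * real m) / ?w)))
      sums (((?w + x) powr p + (?w - x) powr p) / 2 / ?w)"
    using sums_divide[OF even_gen_binomial_sums[OF abs_less_sqrt_one_plus_square], of p x ?w]
    by (simp add: mult.assoc)
  moreover have "?w powr (p - 2 * real m) / ?w = (1 + x\<^sup>2) powr (p/2 - 1/2 - real m)" for m
  proof -
    have "?w powr (p - 2 * real m) / ?w = ?w powr (p - 2 * real m - 1)"
      using w by (simp add: powr_diff)
    also have "\<dots> = (1 + x\<^sup>2) powr (1/2 * (p - 2 * real m - 1))"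
      by (simp add: powr_half_sqrt[symmetric] powr_powr)
    finally show ?thesis by (simp add: algebra_simps diff_divide_distrib)
  qed
  moreover have "((?w + x) powr p + (?w - x) powr p) / 2 / ?w
      = (period_density p x + period_density p (-x)) / 2"
    by (simp add: period_density_def add_divide_distrib mult.commute)
  ultimately show ?thesis by (simp only:)
qed

text \<open>The odd part of the density integrates to zero over a full turn, and the series of the
  even part has a summable majorant whatever the size of \<open>A\<close>.\<close>

lemma integral_period_density_sums:
  "(\<lambda>m. (p gchoose (2*m)) *
      integral {-pi..pi} (\<lambda>\<theta>. (A * sin \<theta>) ^ (2*m) * (1 + (A * sin \<theta>)\<^sup>2) powr (p/2 - 1/2 - real m)))
    sums integral {-pi..pi} (\<lambda>\<theta>. period_density p (A * sin \<theta>))"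
proof -
  let ?D = "\<lambda>\<theta>. period_density p (A * sin \<theta>)"
  let ?h = "\<lambda>m \<theta>. (A * sin \<theta>) ^ (2*m) * (1 + (A * sin \<theta>)\<^sup>2) powr (p/2 - 1/2 - real m)"
  \<comment> \<open>The quotient \<open>x\<^sup>2 / (1 + x\<^sup>2)\<close> grows with
    \<open>x\<^sup>2\<close>, so \<open>r\<close> bounds it for all
    \<open>x = A * sin \<theta>\<close>; being below 1, it drives the majorant.\<close>
  define r where "r = A\<^sup>2 / (1 + A\<^sup>2)"
  have r: "0 \<le> r" "r < 1"
    by (auto simp: r_def add_pos_nonneg divide_less_eq_1)
  have nz: "1 + y\<^sup>2 \<noteq> 0" for y :: real
    by (simp add: add_nonneg_eq_0_iff)
  have pos: "1 + y\<^sup>2 > 0" for y :: real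
    by (simp add: add_pos_nonneg)
  have "continuous_on {-pi..pi} (\<lambda>\<theta>. (1 + (A * sin \<theta>)\<^sup>2) powr (p/2 - 1/2))"
    using nz by (intro continuous_intros) auto
  then have "bounded ((\<lambda>\<theta>. (1 + (A * sin \<theta>)\<^sup>2) powr (p/2 - 1/2)) ` {-pi..pi})"
    by (intro compact_imp_bounded compact_continuous_image) auto
  then obtain K where K: "(1 + (A * sin \<theta>)\<^sup>2) powr (p/2 - 1/2) \<le> K" if "\<theta> \<in> {-pi..pi}" for \<theta>
    unfolding bounded_iff by fastforce
  have summ: "summable (\<lambda>m. K * norm ((p gchoose (2*m)) * sqrt r ^ (2*m)))"
  proof -
    \<comment> \<open>The majorant in \<open>m\<close> is the even-indexed part of the absolutely
      convergent binomial series at \<open>sqrt r\<close>.\<close>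
    have "summable (\<lambda>n. norm ((p gchoose n) * sqrt r ^ n))"
      using r by (intro abs_summable_in_conv_radius) (auto simp: conv_radius_gchoose)
    then have "summable ((\<lambda>n. norm ((p gchoose n) * sqrt r ^ n)) \<circ> (\<lambda>m. 2*m))"
      by (rule summable_reindex) (auto simp: inj_def)
    then show ?thesis by (intro summable_mult) (simp add: o_def)
  qed
  have bound: "\<bar>(p gchoose (2*m)) * ?h m \<theta>\<bar> \<le> K * norm ((p gchoose (2*m)) * sqrt r ^ (2*m))"
    if "\<theta> \<in> {-pi..pi}" for m \<theta>
  proof -
    let ?x = "A * sin \<theta>"
    have "?x\<^sup>2 \<le> A\<^sup>2"
      by (simp add: power_mult_distrib mult_left_le abs_square_le_1)
    then have "?x\<^sup>2 / (1 + ?x\<^sup>2) \<le> r"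
      using pos[of ?x] pos[of A] by (simp add: r_def field_simps)
    then have "(?x\<^sup>2 / (1 + ?x\<^sup>2)) ^ m \<le> r ^ m"
      by (intro power_mono) auto
    moreover have "?h m \<theta> = (?x\<^sup>2 / (1 + ?x\<^sup>2)) ^ m * (1 + ?x\<^sup>2) powr (p/2 - 1/2)"
      using pos[of ?x] by (simp add: powr_diff powr_realpow power_mult power_divide)
    ultimately have "?h m \<theta> \<le> r ^ m * K"
      using K[OF that] r by (auto intro: mult_mono)
    moreover have h: "0 \<le> ?h m \<theta>" by simp
    ultimately have "\<bar>p gchoose (2*m)\<bar> * ?h m \<theta> \<le> \<bar>p gchoose (2*m)\<bar> * (r ^ m * K)"
      by (intro mult_left_mono) auto
    moreover have "sqrt r ^ (2*m) = r ^ m"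
      using r by (simp add: power_mult)
    ultimately show ?thesis
      using r unfolding abs_mult[of "p gchoose (2*m)"] abs_of_nonneg[OF h]
      by (simp add: abs_mult mult_ac)
  qed
  have cont: "continuous_on {-pi..pi} (\<lambda>\<theta>. (p gchoose (2*m)) * ?h m \<theta>)" for m
    using nz by (intro continuous_intros) auto
  have "(\<lambda>m. integral {-pi..pi} (\<lambda>\<theta>. (p gchoose (2*m)) * ?h m \<theta>))
      sums integral {-pi..pi} (\<lambda>\<theta>. (?D \<theta> + period_density p (- (A * sin \<theta>))) / 2)"
    by (rule sums_integral_of_normal_series[OF cont bound summ even_part_period_density_sums])
  moreover have "integral {-pi..pi} (\<lambda>\<theta>. (?D \<theta> + period_density p (- (A * sin \<theta>))) / 2)
      = integral {-pi..pi} ?D"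
  proof -
    have int: "?D integrable_on {-pi..pi}" "(\<lambda>\<theta>. period_density p (- (A * sin \<theta>))) integrable_on {-pi..pi}"
      by (intro integrable_continuous_real continuous_intros)+
    have "integral {-pi..pi} (\<lambda>\<theta>. period_density p (- (A * sin \<theta>))) = integral {-pi..pi} ?D"
      using Henstock_Kurzweil_Integration.integral_reflect_real[of pi "-pi" ?D] by simp
    then show ?thesis
      using int by (simp add: integral_add)
  qed
  ultimately show ?thesis by simp
qed

section \<open>Rotations with position-dependent speed\<close>

text \<open>Measured by an angle that advances at rate \<open>\<omega> (X t)\<close>, the motion is
  a uniform rotation of radius \<open>\<bar>A\<bar>\<close>, and \<open>T\<close> is the time in
  which the angle gains \<open>2*pi\<close>. For minimality, \<open>A \<noteq> 0\<close> lets the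
  position determine the angle modulo \<open>2*pi\<close>; at \<open>A = 0\<close> the point
  rests.\<close>

lemma speed_reparametrised_rotation_period:
  fixes X Y \<omega> :: "real \<Rightarrow> real"
  assumes X: "\<And>t. (X has_real_derivative \<omega> (X t) * Y t) (at t)"
    and Y: "\<And>t. (Y has_real_derivative - \<omega> (X t) * X t) (at t)"
    and init: "X 0 = A" "Y 0 = 0"
    and \<omega>: "continuous_on UNIV \<omega>" "\<And>x. 0 < \<omega> x"
  defines "T \<equiv> integral {-pi..pi} (\<lambda>\<theta>. 1 / \<omega> (A * sin \<theta>))"
  shows "0 < T" and "X (t + T) = X t" and "Y (t + T) = Y t"
    and "A \<noteq> 0 \<Longrightarrow> 0 < S \<Longrightarrow> X S = A \<Longrightarrow> Y S = 0 \<Longrightarrow> T \<le> S"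
proof -
  \<comment> \<open>Global antiderivatives serve twice: for the angle as a function of time and for
    time as a function of the angle.\<close>
  have antiderivative: "\<exists>F. \<forall>x. (F has_real_derivative f x) (at x)"
    if "continuous_on UNIV f" for f :: "real \<Rightarrow> real"
    using that einterval_antiderivative[of "-\<infinity>" \<infinity> f]
    by (auto simp: has_real_derivative_iff_has_vector_derivative continuous_on_eq_continuous_at)
  have "continuous_on UNIV X"
    using X by (meson DERIV_isCont continuous_at_imp_continuous_on)
  then have "continuous_on UNIV (\<lambda>t. \<omega> (X t))"
    using continuous_on_compose2[OF \<omega>(1)] by auto
  then obtain \<theta>0 where \<theta>0: "\<And>t. (\<theta>0 has_real_derivative \<omega> (X t)) (at t)"
    using antiderivative by blast
  \<comment> \<open>The offset \<open>pi/2\<close> matches the initial point: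
    \<open>A * sin (pi/2) = A\<close> and \<open>A * cos (pi/2) = 0\<close>.\<close>
  define \<theta> where "\<theta> t = \<theta>0 t - \<theta>0 0 + pi/2" for t
  have \<theta>: "(\<theta> has_real_derivative \<omega> (X t)) (at t)" for t
    unfolding \<theta>_def using \<theta>0 by (auto intro!: derivative_eq_intros)
  have \<theta>_0: "\<theta> 0 = pi/2" by (simp add: \<theta>_def)

  \<comment> \<open>These are the components of \<open>(X, Y)\<close> in a frame turning with
    \<open>\<theta>\<close>; the equations of motion make them constant.\<close>
  have "((\<lambda>t. X t * cos (\<theta> t) - Y t * sin (\<theta> t)) has_real_derivative 0) (at t)"
    and "((\<lambda>t. X t * sin (\<theta> t) + Y t * cos (\<theta> t)) has_real_derivative 0) (at t)" for t
    by (rule derivative_eq_intros X Y \<theta> refl | simp add: algebra_simps)+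
  then have "X t * cos (\<theta> t) - Y t * sin (\<theta> t) = X 0 * cos (\<theta> 0) - Y 0 * sin (\<theta> 0)"
    and "X t * sin (\<theta> t) + Y t * cos (\<theta> t) = X 0 * sin (\<theta> 0) + Y 0 * cos (\<theta> 0)" for t
    by (metis (mono_tags, lifting) DERIV_isconst_all)+
  then have rot: "X t * cos (\<theta> t) - Y t * sin (\<theta> t) = 0" "X t * sin (\<theta> t) + Y t * cos (\<theta> t) = A" for t
    by (simp_all add: init \<theta>_0)
  have X_eq: "X t = A * sin (\<theta> t)" and Y_eq: "Y t = A * cos (\<theta> t)" for t
  proof -
    have sc: "sin (\<theta> t) ^ 2 + cos (\<theta> t) ^ 2 = 1" by simp
    show "X t = A * sin (\<theta> t)" using rot[of t] sc by algebra
    show "Y t = A * cos (\<theta> t)" using rot[of t] sc by algebra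
  qed

  have "continuous_on UNIV (\<lambda>x. 1 / \<omega> (A * sin x))"
    using \<omega>(2) by (intro continuous_intros continuous_on_compose2[OF \<omega>(1)]) (auto simp: less_imp_neq[symmetric])
  then obtain F where F: "\<And>x. (F has_real_derivative 1 / \<omega> (A * sin x)) (at x)"
    using antiderivative by blast
  have F_less: "F x < F y" if "x < y" for x y
  proof (rule DERIV_pos_imp_increasing[OF that])
    show "\<exists>D. (F has_real_derivative D) (at z) \<and> 0 < D" for z
      using F[of z] \<omega>(2)[of "A * sin z"] by (intro exI[of _ "1 / \<omega> (A * sin z)"]) auto
  qed
  then have F_inj: "x = y" if "F x = F y" for x y
    using that by (metis less_irrefl linorder_neqE_linordered_idom)
  have T_F: "T = F pi - F (-pi)"
    unfolding T_def using F
    by (intro integral_unique fundamental_theorem_of_calculus)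
      (auto simp flip: has_real_derivative_iff_has_vector_derivative intro: has_field_derivative_at_within)
  then show T_pos: "0 < T"
    using F_less[of "-pi" pi] by simp
  \<comment> \<open>The derivative of \<open>F\<close> is \<open>2*pi\<close>-periodic, so a full
    turn changes \<open>F\<close> by a constant, read off at \<open>-pi\<close>.\<close>
  have F_shift: "F (x + 2*pi) = F x + T" for x
  proof -
    have "((\<lambda>x. F (x + 2*pi) - F x) has_real_derivative 0) (at x)" for x
      using DERIV_diff[OF F[of "x + 2*pi", THEN DERIV_shift[THEN iffD1]] F[of x]] by simp
    then have "F (x + 2*pi) - F x = F (-pi + 2*pi) - F (-pi)"
      by (metis (mono_tags, lifting) DERIV_isconst_all)
    then show ?thesis by (simp add: T_F)
  qed
  \<comment> \<open>\<open>F\<close> turns angle back into time: along the motion its derivative is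
    the reciprocal speed times the speed, that is 1.\<close>
  have F_\<theta>: "F (\<theta> t) = t + F (pi/2)" for t
  proof -
    have "((\<lambda>t. F (\<theta> t) - t) has_real_derivative 0) (at t)" for t
      using DERIV_chain2[OF F \<theta>, of t] \<omega>(2)[of "X t"]
      by (auto intro!: derivative_eq_intros simp: X_eq)
    then have "F (\<theta> t) - t = F (\<theta> 0) - 0"
      by (metis (mono_tags, lifting) DERIV_isconst_all)
    then show ?thesis by (simp add: \<theta>_0)
  qed
  have "\<theta> (t + T) = \<theta> t + 2*pi"
    by (rule F_inj) (simp add: F_shift F_\<theta>)
  then show "X (t + T) = X t" "Y (t + T) = Y t"
    by (simp_all add: X_eq Y_eq)
  show "T \<le> S" if "A \<noteq> 0" "0 < S" "X S = A" "Y S = 0"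
  proof -
    have "sin (\<theta> S) = sin (pi/2) \<and> cos (\<theta> S) = cos (pi/2)"
      using that X_eq[of S] Y_eq[of S] by simp
    then obtain n :: int where n: "\<theta> S = pi/2 + 2*pi*n"
      unfolding sin_cos_eq_iff by blast
    \<comment> \<open>\<open>F\<close> is strictly increasing, so positive elapsed time puts the
      angle beyond its initial value; the return therefore takes at least one full turn.\<close>
    have "F (pi/2) < F (\<theta> S)" using F_\<theta>[of S] that by simp
    then have "pi/2 < \<theta> S"
      using F_less by (metis less_asym linorder_neqE_linordered_idom)
    then have "n > 0" using n by (simp add: zero_less_mult_iff)
    then have "2*pi*1 \<le> 2*pi*n" by (intro mult_left_mono) auto
    then have "pi/2 + 2*pi \<le> \<theta> S" using n by simp
    then have "F (pi/2 + 2*pi) \<le> F (\<theta> S)"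
      using F_less by (metis less_eq_real_def)
    then show "T \<le> S" using F_shift[of "pi/2"] F_\<theta>[of S] by linarith
  qed
qed

section \<open>The oscillator in rotation coordinates\<close>

lemma solves_oscillatorD:
  assumes "solves_oscillator \<alpha> c q0 q"
  shows "0 < q t" and "(q has_real_derivative deriv q t) (at t)"
    and "(deriv q has_real_derivative
      c * (\<alpha> + 1) / (8 * q t powr (\<alpha> + 2)) - c * (\<alpha> + 1) / 8 * q t powr \<alpha>) (at t)"
    and "q 0 = q0" and "deriv q 0 = 0"
proof -
  have eq: "deriv (deriv q) t
      = c * (\<alpha> + 1) / (8 * q t powr (\<alpha> + 2)) - c * (\<alpha> + 1) / 8 * q t powr \<alpha>"
    using assms unfolding solves_oscillator_def by (metis add_diff_cancel_right')
  show "0 < q t" "q 0 = q0" "deriv q 0 = 0"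
    using assms by (auto simp: solves_oscillator_def)
  have "(q has_real_derivative deriv q t) (at t)"
    and "(deriv q has_real_derivative deriv (deriv q) t) (at t)"
    using assms by (auto simp: solves_oscillator_def DERIV_deriv_iff_real_differentiable)
  then show "(q has_real_derivative deriv q t) (at t)"
    and "(deriv q has_real_derivative
      c * (\<alpha> + 1) / (8 * q t powr (\<alpha> + 2)) - c * (\<alpha> + 1) / 8 * q t powr \<alpha>) (at t)"
    unfolding eq .
qed

text \<open>The hyperbolic sine of \<open>(\<alpha> + 1) / 2 * ln x\<close>, in which the potential is a pure square.\<close>

definition iso_coord :: "real \<Rightarrow> real \<Rightarrow> real" where
  "iso_coord \<alpha> x = (x powr ((\<alpha> + 1) / 2) - x powr - ((\<alpha> + 1) / 2)) / 2"

text \<open>This is the matching hyperbolic cosine: the two powers multiply to 1, which gives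
  \<open>1 + sinh^2 = cosh^2\<close>.\<close>

lemma sqrt_one_plus_iso_coord_square:
  assumes "0 < x"
  shows "sqrt (1 + (iso_coord \<alpha> x)\<^sup>2) = (x powr ((\<alpha> + 1) / 2) + x powr - ((\<alpha> + 1) / 2)) / 2"
proof -
  define a where "a = (\<alpha> + 1) / 2"
  define u v where "u = x powr a" and "v = x powr - a"
  have "u * v = 1"
    using assms by (simp add: u_def v_def flip: powr_add)
  then have "1 + ((u - v) / 2)\<^sup>2 = ((u + v) / 2)\<^sup>2"
    by (simp add: power2_eq_square field_simps)
  moreover have "0 \<le> (u + v) / 2" by (simp add: u_def v_def)
  ultimately have "sqrt (1 + ((u - v) / 2)\<^sup>2) = (u + v) / 2"
    by (simp only: real_sqrt_abs abs_of_nonneg)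
  then show ?thesis
    by (simp only: iso_coord_def u_def v_def a_def)
qed

text \<open>Hyperbolic cosine plus sine is the exponential. This inverts \<open>iso_coord\<close>,
  so it gives injectivity, and it turns the power in \<open>period_density\<close> into the position
  itself.\<close>

lemma powr_of_iso_coord:
  assumes "0 < x" "0 < \<alpha>"
  shows "(sqrt (1 + (iso_coord \<alpha> x)\<^sup>2) + iso_coord \<alpha> x) powr (2 / (\<alpha> + 1)) = x"
proof -
  have "sqrt (1 + (iso_coord \<alpha> x)\<^sup>2) + iso_coord \<alpha> x = x powr ((\<alpha> + 1) / 2)"
    unfolding sqrt_one_plus_iso_coord_square[OF assms(1)] unfolding iso_coord_def
    by (simp add: add_divide_distrib diff_divide_distrib)
  moreover have "(\<alpha> + 1) / 2 * (2 / (\<alpha> + 1)) = 1"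
    using assms by simp
  ultimately show ?thesis
    using assms by (simp only: powr_powr powr_one)
qed

lemma iso_coord_eq_iff:
  assumes "0 < x" "0 < y" "0 < \<alpha>"
  shows "iso_coord \<alpha> x = iso_coord \<alpha> y \<longleftrightarrow> x = y"
  using powr_of_iso_coord assms by metis

text \<open>The potential is \<open>c / 2\<close> times the squared coordinate, so \<open>k\<close>
  is the radius of the rotation.\<close>

lemma modulus_eq_abs_iso_coord:
  assumes "0 < c" "0 < x"
  shows "modulus \<alpha> c x = \<bar>iso_coord \<alpha> x\<bar>"
proof -
  have "2 * potential \<alpha> c x / c = (iso_coord \<alpha> x)\<^sup>2"
    unfolding potential_def iso_coord_def powr_minus
    using assms by (simp add: field_simps power2_eq_square)
  then show ?thesis by (simp add: modulus_def)
qed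

text \<open>Along the orbit \<open>\<omega>\<close> is \<open>sqrt c\<close> times the derivative of
  \<open>iso_coord\<close> in the position. The first equation is then the chain rule, and the
  second is Newton's law for a potential that is \<open>c / 2\<close> times a square.\<close>

lemma iso_coord_dynamics:
  fixes \<alpha> c q0 :: real and q :: "real \<Rightarrow> real"
  assumes "0 < \<alpha>" "0 < c" and sol: "solves_oscillator \<alpha> c q0 q"
  defines "X \<equiv> \<lambda>t. iso_coord \<alpha> (q t)" and "Y \<equiv> \<lambda>t. deriv q t / sqrt c"
    and "\<omega> \<equiv> \<lambda>x. sqrt c * (\<alpha> + 1) / 2 / period_density (2 / (\<alpha> + 1)) x"
  shows "(X has_real_derivative \<omega> (X t) * Y t) (at t)"
    and "(Y has_real_derivative - \<omega> (X t) * X t) (at t)"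
proof -
  define a where "a = (\<alpha> + 1) / 2"
  define u v where "u = q t powr a" and "v = q t powr (-a)"
  note q = solves_oscillatorD[OF sol]
  have a: "a > 0" "\<alpha> = 2 * a - 1" "(\<alpha> + 1) / 2 = a"
    using assms by (auto simp: a_def field_simps)
  have uv: "u > 0" "v > 0" "u * v = 1"
    using q(1)[of t] by (simp_all add: u_def v_def flip: powr_add)
  have X_t: "X t = (u - v) / 2"
    by (simp only: X_def iso_coord_def a(3) u_def v_def)
  have "\<omega> (X t) = sqrt c * a * sqrt (1 + (X t)\<^sup>2) / q t"
    using powr_of_iso_coord[OF q(1)[of t] \<open>0 < \<alpha>\<close>] by (simp add: \<omega>_def period_density_def X_def a_def)
  also have "sqrt (1 + (X t)\<^sup>2) = (u + v) / 2"
    using sqrt_one_plus_iso_coord_square[OF q(1)[of t], of \<alpha>]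
    by (simp only: X_def u_def v_def a(3))
  finally have \<omega>_X: "\<omega> (X t) = sqrt c * a * ((u + v) / 2) / q t" .
  have "((\<lambda>s. (q s powr a - q s powr (-a)) / 2) has_real_derivative
      (a * q t powr (a - 1) * deriv q t - (-a) * q t powr (-a - 1) * deriv q t) / 2) (at t)"
    by (rule derivative_eq_intros DERIV_powr q(1,2) refl | use q(1)[of t] in simp)+
  moreover have "(a * q t powr (a - 1) * deriv q t - (-a) * q t powr (-a - 1) * deriv q t) / 2 = \<omega> (X t) * Y t"
    unfolding \<omega>_X using q(1)[of t] \<open>0 < c\<close>
    by (simp add: Y_def powr_diff u_def v_def field_simps)
  ultimately show "(X has_real_derivative \<omega> (X t) * Y t) (at t)"
    by (simp only: X_def iso_coord_def a(3))
  have uu: "u * u = q t powr (2 * a)"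
    by (simp add: u_def flip: powr_add)
  \<comment> \<open>Written in \<open>u\<close> and \<open>v\<close>, the force is proportional to
    \<open>(v * v - u * u) / q t\<close>; factoring the difference of squares gives
    \<open>X t\<close> from \<open>u - v\<close> and \<open>\<omega> (X t)\<close> from
    \<open>u + v\<close>.\<close>
  have "q t powr (\<alpha> + 2) = u * u * q t"
    unfolding uu using q(1)[of t] by (simp add: a(2) powr_add)
  moreover have "q t powr \<alpha> = u * u / q t"
    unfolding uu using q(1)[of t] by (simp add: a(2) powr_diff)
  moreover have "1 / (u * u) = v * v"
    using uv by (simp add: field_simps)
  moreover have "c / sqrt c = sqrt c"
    using \<open>0 < c\<close> by (simp add: real_div_sqrt)
  moreover have "(c * (\<alpha> + 1) / (8 * (u * u * q t)) - c * (\<alpha> + 1) / 8 * (u * u / q t)) / sqrt c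
      = c / sqrt c * a / 4 * (1 / (u * u) - u * u) / q t"
    using q(1)[of t] uv \<open>0 < c\<close> by (simp add: a(2) divide_simps) (simp add: algebra_simps)
  moreover have "sqrt c * a / 4 * (v * v - u * u) / q t = - \<omega> (X t) * X t"
    unfolding \<omega>_X unfolding X_t using q(1)[of t] by (simp add: field_simps)
  ultimately have "(c * (\<alpha> + 1) / (8 * q t powr (\<alpha> + 2)) - c * (\<alpha> + 1) / 8 * q t powr \<alpha>) / sqrt c
      = - \<omega> (X t) * X t"
    by (simp only:)
  with DERIV_cdivide[OF q(3)[of t], of "sqrt c"]
  show "(Y has_real_derivative - \<omega> (X t) * X t) (at t)"
    by (simp add: Y_def)
qed

section \<open>Matching the double series with the period\<close>

text \<open>Below amplitude 1 this is \<open>binomial_moment_sums\<close>, halved. For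
  \<open>\<alpha> = 1\<close> the upper entry of the first binomial is 1 and that of the second is
  \<open>- real m\<close>, so only \<open>m = n = 0\<close> survives, with value \<open>pi\<close>,
  at every amplitude.\<close>

lemma series_term_sums:
  assumes "0 < \<alpha>" "\<bar>A\<bar> < 1 \<or> \<alpha> = 1"
  shows "(\<lambda>n. series_term \<alpha> \<bar>A\<bar> m n) sums
    ((2 / (\<alpha> + 1) gchoose (2*m)) * integral {-pi..pi} (\<lambda>\<theta>. (A * sin \<theta>) ^ (2*m) *
      (1 + (A * sin \<theta>)\<^sup>2) powr (1 / (\<alpha> + 1) - 1/2 - real m)) / 2)"
proof (cases "\<bar>A\<bar> < 1")
  case True
  have "\<bar>A\<bar> ^ (2 * (m + n)) = A ^ (2 * (m + n))" for n
    by (rule power_even_abs) simp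
  then show ?thesis
    using sums_divide[OF sums_mult[OF binomial_moment_sums[OF True, of "1 / (\<alpha> + 1) - 1/2 - real m" m],
          of "2 / (\<alpha> + 1) gchoose (2*m)"], of 2]
    unfolding series_term_def by (simp only:) (simp add: mult.assoc)
next
  case False
  with assms have [simp]: "\<alpha> = 1" by simp
  show ?thesis
  proof (cases "m = 0")
    case [simp]: True
    have "series_term \<alpha> \<bar>A\<bar> m n = (if n = 0 then pi else 0)" for n
      by (cases n) (simp_all add: series_term_def Beta_def Gamma_one_half_real)
    moreover have "1 + (A * sin x)\<^sup>2 \<noteq> 0" for x
      by (simp add: add_nonneg_eq_0_iff)
    ultimately show ?thesis
      using sums_single[of 0 "\<lambda>_. pi"] by simp
  next
    case False
    then have "(1 gchoose (2*m) :: real) = 0"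
      using binomial_gbinomial[of 1 "2*m", where 'a=real] by (simp add: binomial_eq_0)
    then show ?thesis by (simp add: series_term_def)
  qed
qed

text \<open>The condition \<open>k < 1 \<or> \<alpha> = 1\<close> secures convergence of the inner
  sums. The value \<open>q0 = 1\<close> is the equilibrium: the solution is constant, every positive
  number is a period, and no least one exists.\<close>

theorem theorem1p1:
  fixes \<alpha> c q0 k :: real and q :: "real \<Rightarrow> real"
  assumes "\<alpha> > 0" and "c > 0" and "q0 > 0"
    and "solves_oscillator \<alpha> c q0 q"
    and "k = modulus \<alpha> c q0"
    and "k < 1 \<or> \<alpha> = 1"
  shows "\<exists>T. is_period (phase_curve q) T
           \<and> (q0 \<noteq> 1 \<longrightarrow> is_least_period (phase_curve q) T)
           \<and> (\<forall>m. summable (\<lambda>n. series_term \<alpha> k m n))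
           \<and> summable (\<lambda>m. \<Sum>n. series_term \<alpha> k m n)
           \<and> T = 4 / (sqrt c * (\<alpha> + 1)) * (\<Sum>m. \<Sum>n. series_term \<alpha> k m n)"
proof -
  define A where "A = iso_coord \<alpha> q0"
  define p where "p = 2 / (\<alpha> + 1)"
  define X where "X t = iso_coord \<alpha> (q t)" for t
  define Y where "Y t = deriv q t / sqrt c" for t
  define \<omega> where "\<omega> x = sqrt c * (\<alpha> + 1) / 2 / period_density p x" for x
  define T where "T = integral {-pi..pi} (\<lambda>\<theta>. 1 / \<omega> (A * sin \<theta>))"
  note q = solves_oscillatorD[OF \<open>solves_oscillator \<alpha> c q0 q\<close>]
  have k: "k = \<bar>A\<bar>"
    using assms by (simp add: modulus_eq_abs_iso_coord A_def)
  have der: "(X has_real_derivative \<omega> (X t) * Y t) (at t)"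
      "(Y has_real_derivative - \<omega> (X t) * X t) (at t)" for t
    using iso_coord_dynamics[OF assms(1,2,4)] unfolding X_def Y_def \<omega>_def p_def by simp_all
  have init: "X 0 = A" "Y 0 = 0"
    by (simp_all add: X_def Y_def A_def q)
  have \<omega>: "continuous_on UNIV \<omega>" "\<And>x. 0 < \<omega> x"
    using assms period_density_pos unfolding \<omega>_def
    by (auto intro!: continuous_intros simp: less_imp_neq[OF period_density_pos, symmetric])
  note rotation = speed_reparametrised_rotation_period[OF der init \<omega>, folded T_def]
  have period: "is_period (phase_curve q) T"
    unfolding is_period_def phase_curve_def
  proof (intro conjI allI)
    fix t
    have "q (t + T) = q t"
      using rotation(2)[of t] iso_coord_eq_iff q(1) assms(1) by (simp add: X_def)
    moreover have "deriv q (t + T) = deriv q t"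
      using rotation(3)[of t] assms(2) by (simp add: Y_def)
    ultimately show "(q (t + T), deriv q (t + T)) = (q t, deriv q t)" by simp
  qed (rule rotation(1))
  have least: "is_least_period (phase_curve q) T" if "q0 \<noteq> 1"
    unfolding is_least_period_def
  proof (intro conjI allI impI period)
    fix S assume S: "is_period (phase_curve q) S"
    \<comment> \<open>The equilibrium is the zero of the coordinate, so injectivity gives a nonzero
      amplitude elsewhere.\<close>
    have "iso_coord \<alpha> 1 = 0" by (simp add: iso_coord_def)
    then have "A \<noteq> 0"
      using iso_coord_eq_iff[of q0 1 \<alpha>] that assms by (simp add: A_def)
    moreover have "q S = q0" "deriv q S = 0"
      using S q(4,5) unfolding is_period_def phase_curve_def by (metis add_0 prod.inject)+
    ultimately show "T \<le> S"
      using S by (intro rotation(4)) (simp_all add: X_def Y_def A_def is_period_def)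
  qed
  have inner: "(\<lambda>n. series_term \<alpha> k m n) sums
    ((p gchoose (2*m)) * integral {-pi..pi} (\<lambda>\<theta>. (A * sin \<theta>) ^ (2*m) *
      (1 + (A * sin \<theta>)\<^sup>2) powr (p/2 - 1/2 - real m)) / 2)" for m
  proof -
    have p2: "p / 2 = 1 / (\<alpha> + 1)" using assms(1) by (simp add: p_def field_simps)
    show ?thesis
      unfolding p2 unfolding p_def k using assms(1,6) k by (intro series_term_sums) auto
  qed
  have "(\<lambda>m. \<Sum>n. series_term \<alpha> k m n) sums
      (integral {-pi..pi} (\<lambda>\<theta>. period_density p (A * sin \<theta>)) / 2)"
    unfolding sums_unique[OF inner, symmetric]
    by (intro sums_divide integral_period_density_sums)
  then have outer: "summable (\<lambda>m. \<Sum>n. series_term \<alpha> k m n)"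
      "(\<Sum>m. \<Sum>n. series_term \<alpha> k m n)
        = integral {-pi..pi} (\<lambda>\<theta>. period_density p (A * sin \<theta>)) / 2"
    by (simp_all add: sums_iff)
  have "T = 4 / (sqrt c * (\<alpha> + 1)) * (\<Sum>m. \<Sum>n. series_term \<alpha> k m n)"
    \<comment> \<open>The 4 is a product of two factors 2: one from \<open>1 / \<omega>\<close>,
      which is \<open>2 / (sqrt c * (\<alpha> + 1))\<close> times the density, and one from the
      double series being half the integral.\<close>
    unfolding outer(2) by (simp add: T_def \<omega>_def)
  with period least outer(1) sums_summable[OF inner] show ?thesis
    by (intro exI[of _ T] conjI impI allI)
qed

end
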